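(* Let $\Gamma$ be a confusion graph on a finite source alphabet $\mathcal{X}$ and let $g$ be a guessing capability function. Then the multi-guess maximal leakage rate $\mathcal{L}_g$ satisfies $$\log|V(\Gamma)|-\log\alpha(\Gamma)\le \mathcal{L}_g\le \log\chi_f(\Gamma),$$ where $\alpha(\Gamma)$ is the independence number and $\chi_f(\Gamma)$ the fractional chromatic number of $\Gamma$.
   Context: Graphs are finite, simple and undirected. The confusion graph $\Gamma$ has vertex set $V(\Gamma)=\mathcal{X}$, the finite alphabet of a discrete memoryless stationary source (so $P_{X^t}(x^t)=\prod_jP_X(x_j)$). For a positive integer $t$, $\Gamma_t=\Gamma^{\lor t}$ is the graph on $\mathcal{X}^t$ in which $x^t$ and $v^t$ are adjacent iff $\{x_j,v_j\}$ is an edge of $\Gamma$ for some $j\in\{1,\dots,t\}$. A mapping scheme is a conditional distribution $P_{Y|X^t}$ from $\mathcal{X}^t$ to a finite code alphabet $\mathcal{Y}$ (which may be chosen freely). It is valid if for every $y\in\mathcal{Y}$ the set $\{x^t\in\mathcal{X}^t: P_{Y|X^t}(y|x^t)>0\}$ is an independent set of $\Gamma_t$. A guessing capability function is a non-decreasing function $g$ from the positive integers to the positive integers with $g(t)\le\alpha(\Gamma_t)=\alpha(\Gamma)^t$ for all $t$. The multi-guess maximal leakage of a valid mapping is $$L^t_g(P_{Y|X^t})=\log\max_{P_X}\frac{\sum_{y\in\mathcal{Y}}\max_{K\subseteq\mathcal{X}^t,|K|=g(t)}\sum_{x^t\in K}P_{X^t}(x^t)P_{Y|X^t}(y|x^t)}{\max_{K\subseteq\mathcal{X}^t,|K|=g(t)}\sum_{x^t\in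 K}P_{X^t}(x^t)},$$ the outer maximum being over all probability distributions $P_X$ on $\mathcal{X}$. The multi-guess maximal leakage rate is $\mathcal{L}_g=\lim_{t\to\infty}\frac1t\inf L^t_g(P_{Y|X^t})$, the infimum being over all valid mappings for length $t$; the limit is assumed to exist. $\chi_f(G)=\inf_b\chi_b(G)/b$, where $\chi_b(G)$ is the least $m$ for which there is a multiset $\{T_1,\dots,T_m\}$ of independent sets of $G$ such that every vertex is in exactly $b$ of them. The logarithm has a fixed base greater than 1. *)

theory Defs
  imports "HOL-Probability.Probability" "Graph_Theory.Pair_Digraph"
begin

text \<open>
  Finite simple undirected graphs are the records satisfying \<^locale>\<open>pair_graph\<close>: a finite vertex
  set together with a symmetric, loop-free set of arcs, so that \<open>{u, v}\<close> is an edge iff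
  \<open>(u, v) \<in> parcs G\<close>.
\<close>

definition independent_set :: "'a pair_pre_digraph \<Rightarrow> 'a set \<Rightarrow> bool" where
  "independent_set G S \<longleftrightarrow> S \<subseteq> pverts G \<and> (\<forall>u\<in>S. \<forall>v\<in>S. (u, v) \<notin> parcs G)"

definition independence_number :: "'a pair_pre_digraph \<Rightarrow> nat" where
  "independence_number G = Max (card ` {S. independent_set G S})"

definition multi_chromatic_number :: "'a pair_pre_digraph \<Rightarrow> nat \<Rightarrow> nat" where
  "multi_chromatic_number G b =
     (LEAST m. \<exists>T :: 'a set multiset. size T = m \<and> (\<forall>S \<in># T. independent_set G S) \<and>
                  (\<forall>v \<in> pverts G. size (filter_mset (\<lambda>S. v \<in> S) T) = b))"

definition fractional_chromatic_number :: "'a pair_pre_digraph \<Rightarrow> real" where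
  "fractional_chromatic_number G =
     (INF b\<in>{1..}. real (multi_chromatic_number G b) / real b)"

text \<open>Sequences of length \<open>t\<close> over \<open>V\<close>, with positions indexed from 0.\<close>

abbreviation seqs :: "nat \<Rightarrow> 'a set \<Rightarrow> (nat \<Rightarrow> 'a) set" where
  "seqs t V \<equiv> (\<Pi>\<^sub>E j\<in>{..<t}. V)"

definition or_power :: "'a pair_pre_digraph \<Rightarrow> nat \<Rightarrow> (nat \<Rightarrow> 'a) pair_pre_digraph" where
  "or_power G t =
     \<lparr> pverts = seqs t (pverts G),
       parcs = {(x, v). x \<in> seqs t (pverts G) \<and> v \<in> seqs t (pverts G) \<and>
                        (\<exists>j<t. (x j, v j) \<in> parcs G)} \<rparr>"

lemma pair_graph_or_power:
  assumes "pair_graph G"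
  shows "pair_graph (or_power G t)"
proof -
  interpret pair_graph G by fact
  have fin: "finite (seqs t (pverts G))"
    by (intro finite_PiE) auto
  have "finite (parcs (or_power G t))"
    by (rule finite_subset[of _ "seqs t (pverts G) \<times> seqs t (pverts G)"])
       (use fin in \<open>auto simp: or_power_def\<close>)
  moreover have "symmetric (with_proj (or_power G t))"
    using sym_arcs by (auto simp: symmetric_def or_power_def sym_def)
  moreover have "(u, u) \<notin> parcs G" for u
    using no_loops' by blast
  ultimately show ?thesis
    using fin by unfold_locales (auto simp: or_power_def)
qed

definition guessing_capability :: "'a pair_pre_digraph \<Rightarrow> (nat \<Rightarrow> nat) \<Rightarrow> bool" where
  "guessing_capability G g \<longleftrightarrow>
     mono_on {1..} g \<and>
     (\<forall>t\<ge>1. 1 \<le> g t \<and> g t \<le> independence_number (or_power G t))"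

text \<open>
  A mapping scheme is a Markov kernel \<open>P\<close>, where \<open>P x\<close> is the conditional distribution of the code
  symbol given the source sequence \<open>x\<close>; its values outside the sequences over the vertex set are
  irrelevant. Code alphabets are finite sets of natural numbers, which loses nothing because only
  their cardinality matters.
\<close>

definition valid_mapping ::
    "'a pair_pre_digraph \<Rightarrow> nat \<Rightarrow> nat set \<Rightarrow> ((nat \<Rightarrow> 'a) \<Rightarrow> nat pmf) \<Rightarrow> bool" where
  "valid_mapping G t Y P \<longleftrightarrow>
     finite Y \<and>
     (\<forall>x \<in> seqs t (pverts G). set_pmf (P x) \<subseteq> Y) \<and>
     (\<forall>y \<in> Y. independent_set (or_power G t) {x \<in> seqs t (pverts G). pmf (P x) y > 0})"

definition iid_prob :: "'a pmf \<Rightarrow> nat \<Rightarrow> (nat \<Rightarrow> 'a) \<Rightarrow> real" where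
  "iid_prob p t x = (\<Prod>j<t. pmf p (x j))"

text \<open>The largest total weight of \<open>k\<close> elements of the finite set \<open>S\<close>.\<close>

definition max_guess :: "nat \<Rightarrow> 'b set \<Rightarrow> ('b \<Rightarrow> real) \<Rightarrow> real" where
  "max_guess k S w = (MAX K\<in>{K. K \<subseteq> S \<and> card K = k}. \<Sum>x\<in>K. w x)"

definition guess_ratio ::
    "'a set \<Rightarrow> nat \<Rightarrow> nat \<Rightarrow> nat set \<Rightarrow> ((nat \<Rightarrow> 'a) \<Rightarrow> nat pmf) \<Rightarrow> 'a pmf \<Rightarrow> real" where
  "guess_ratio V t k Y P p =
     (\<Sum>y\<in>Y. max_guess k (seqs t V) (\<lambda>x. iid_prob p t x * pmf (P x) y)) /
     max_guess k (seqs t V) (iid_prob p t)"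

lemma continuous_on_max_guess:
  fixes f :: "'c::topological_space \<Rightarrow> 'b \<Rightarrow> real"
  assumes "finite S" and "k \<le> card S"
    and "\<And>x. x \<in> S \<Longrightarrow> continuous_on D (\<lambda>q. f q x)"
  shows "continuous_on D (\<lambda>q. max_guess k S (f q))"
proof -
  have Max_cont: "continuous_on D (\<lambda>q. Max ((\<lambda>K. \<Sum>x\<in>K. f q x) ` I))"
    if "finite I" "I \<noteq> {}" "I \<subseteq> Pow S" for I
    using that
  proof (induction I rule: finite_ne_induct)
    case (singleton K)
    then show ?case using assms(3) by (auto intro!: continuous_on_sum)
  next
    case (insert K I)
    have "continuous_on D (\<lambda>q. max (\<Sum>x\<in>K. f q x) (Max ((\<lambda>K. \<Sum>x\<in>K. f q x) ` I)))"
      using insert assms(3) by (auto intro!: continuous_on_max continuous_on_sum)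
    then show ?case using insert by simp
  qed
  obtain K where "K \<subseteq> S" "card K = k"
    using obtain_subset_with_card_n[OF assms(2)] by metis
  then show ?thesis
    unfolding max_guess_def using assms(1) by (intro Max_cont) auto
qed

lemma max_guess_iid_prob_pos:
  assumes "finite V" and "set_pmf p \<subseteq> V" and "1 \<le> k" and "k \<le> card (seqs t V)"
  shows "0 < max_guess k (seqs t V) (iid_prob p t)"
proof -
  let ?S = "seqs t V"
  have fin: "finite ?S" using assms(1) by (intro finite_PiE) auto
  obtain v where v: "v \<in> set_pmf p" using set_pmf_not_empty[of p] by blast
  define x where "x = (\<lambda>j\<in>{..<t}. v)"
  have x: "x \<in> ?S" using v assms(2) by (auto simp: x_def)
  have "k - 1 \<le> card (?S - {x})" using assms(4) x fin by (simp add: card_Diff_singleton)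
  then obtain K0 where K0: "K0 \<subseteq> ?S - {x}" "card K0 = k - 1"
    using obtain_subset_with_card_n by metis
  have finK0: "finite K0" using K0(1) fin finite_subset by blast
  have K: "insert x K0 \<subseteq> ?S" "card (insert x K0) = k"
    using K0 x finK0 assms(3) by (auto simp: card_insert_if)
  have "0 < iid_prob p t x"
    unfolding iid_prob_def using v by (intro prod_pos) (auto simp: x_def pmf_positive)
  also have "\<dots> \<le> (\<Sum>y\<in>insert x K0. iid_prob p t y)"
    by (rule member_le_sum) (use finK0 in \<open>auto simp: iid_prob_def intro!: prod_nonneg\<close>)
  also have "\<dots> \<le> max_guess k ?S (iid_prob p t)"
    unfolding max_guess_def by (intro Max_ge) (use fin K in auto)
  finally show ?thesis .
qed

text \<open>
  In the leakage below, the maximum over all source distributions is written as a supremum. By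
  compactness of the probability simplex it is attained.
\<close>

lemma guess_ratio_attains_Sup:
  fixes V :: "'a set"
  assumes "finite V" and "V \<noteq> {}" and "1 \<le> k" and "k \<le> card (seqs t V)"
  shows "\<exists>p. set_pmf p \<subseteq> V \<and> (\<forall>q. set_pmf q \<subseteq> V \<longrightarrow> guess_ratio V t k Y P q \<le> guess_ratio V t k Y P p) \<and>
             guess_ratio V t k Y P p = (SUP q\<in>{q. set_pmf q \<subseteq> V}. guess_ratio V t k Y P q)"
proof -
  let ?S = "seqs t V"
  have fin: "finite ?S" using assms(1) by (intro finite_PiE) auto
  define w :: "('a \<Rightarrow> real) \<Rightarrow> (nat \<Rightarrow> 'a) \<Rightarrow> real" where "w f x = (\<Prod>j<t. f (x j))" for f x
  define D :: "('a \<Rightarrow> real) set"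
    where "D = (\<Pi>\<^sub>E v\<in>UNIV. if v \<in> V then {0..1} else {0}) \<inter> {f. (\<Sum>v\<in>V. f v) = 1}"
  define R where "R f = (\<Sum>y\<in>Y. max_guess k ?S (\<lambda>x. w f x * pmf (P x) y)) / max_guess k ?S (w f)" for f
  have R_pmf: "guess_ratio V t k Y P p = R (pmf p)" for p
    by (simp add: R_def w_def[abs_def] guess_ratio_def iid_prob_def[abs_def])
  have pmf_D: "pmf p \<in> D" if "set_pmf p \<subseteq> V" for p
    using that assms(1) sum_pmf_eq_1[of V p]
    by (auto simp: D_def PiE_UNIV_domain pmf_le_1 set_pmf_iff)
  have D_pmf: "\<exists>p. set_pmf p \<subseteq> V \<and> pmf p = f" if f: "f \<in> D" for f
  proof -
    have f0: "f v = 0" if "v \<notin> V" for v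
      using f that unfolding D_def PiE_UNIV_domain by (auto dest: Pi_mem[where x = v])
    have f1: "0 \<le> f v" for v
      using f unfolding D_def PiE_UNIV_domain
      by (cases "v \<in> V") (auto dest: Pi_mem[where x = v])
    have "(\<integral>\<^sup>+v. ennreal (f v) \<partial>count_space UNIV) = (\<Sum>v\<in>V. ennreal (f v))"
      by (rule nn_integral_count_space'[OF assms(1)]) (use f0 in auto)
    also have "\<dots> = ennreal (\<Sum>v\<in>V. f v)" using f1 by (simp add: sum_ennreal)
    also have "\<dots> = 1" using f by (simp add: D_def)
    finally have e: "(\<integral>\<^sup>+v. ennreal (f v) \<partial>count_space UNIV) = 1" .
    have "pmf (embed_pmf f) = f" using pmf_embed_pmf[OF f1 e] by auto
    then show ?thesis using f0 by (intro exI[of _ "embed_pmf f"]) (auto simp: set_pmf_iff intro: ccontr)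
  qed
  have "compactin euclidean (\<Pi>\<^sub>E v\<in>UNIV. if v \<in> V then {0..1::real} else {0})"
    by (subst euclidean_product_topology[symmetric]) (auto simp: compactin_PiE)
  moreover have "closed {f :: 'a \<Rightarrow> real. (\<Sum>v\<in>V. f v) = 1}"
    by (intro closed_Collect_eq continuous_intros continuous_on_sum) auto
  ultimately have comp: "compact D" by (auto simp: D_def intro: compact_Int_closed)
  have pos: "max_guess k ?S (w f) \<noteq> 0" if "f \<in> D" for f
  proof -
    from D_pmf[OF that] obtain p where p: "set_pmf p \<subseteq> V" "pmf p = f" by blast
    then show ?thesis
      using max_guess_iid_prob_pos[OF assms(1) p(1) assms(3,4)]
      by (simp add: iid_prob_def[abs_def] w_def[abs_def])
  qed
  have w_cont: "continuous_on D (\<lambda>f. w f x)" for x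
    unfolding w_def by (intro continuous_on_prod continuous_on_subset[OF continuous_on_product_coordinates]) auto
  have "continuous_on D R"
    unfolding R_def
    by (intro continuous_on_divide continuous_on_sum continuous_on_max_guess fin assms(4)
        continuous_on_mult continuous_on_const w_cont ballI pos)
  moreover have "D \<noteq> {}"
    using pmf_D[of "pmf_of_set V"] assms(1,2) by auto
  ultimately obtain f where f: "f \<in> D" "\<And>h. h \<in> D \<Longrightarrow> R h \<le> R f"
    using continuous_attains_sup[OF comp] by blast
  from D_pmf[OF f(1)] obtain p where p: "set_pmf p \<subseteq> V" "pmf p = f" by blast
  have le: "guess_ratio V t k Y P q \<le> guess_ratio V t k Y P p" if "set_pmf q \<subseteq> V" for q
    using f(2)[OF pmf_D[OF that]] p(2) by (simp add: R_pmf)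
  have "(SUP q\<in>{q. set_pmf q \<subseteq> V}. guess_ratio V t k Y P q) = guess_ratio V t k Y P p"
    by (rule cSup_eq_maximum) (use p le in auto)
  then show ?thesis using p(1) le by (intro exI[of _ p]) auto
qed

definition multi_guess_leakage ::
    "real \<Rightarrow> 'a pair_pre_digraph \<Rightarrow> (nat \<Rightarrow> nat) \<Rightarrow> nat \<Rightarrow> nat set \<Rightarrow>
     ((nat \<Rightarrow> 'a) \<Rightarrow> nat pmf) \<Rightarrow> real" where
  "multi_guess_leakage b G g t Y P =
     log b (SUP p\<in>{p. set_pmf p \<subseteq> pverts G}. guess_ratio (pverts G) t (g t) Y P p)"

definition normalized_min_leakage ::
    "real \<Rightarrow> 'a pair_pre_digraph \<Rightarrow> (nat \<Rightarrow> nat) \<Rightarrow> nat \<Rightarrow> real" where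
  "normalized_min_leakage b G g t =
     (1 / real t) * (INF (Y, P)\<in>{(Y, P). valid_mapping G t Y P}. multi_guess_leakage b G g t Y P)"

definition leakage_rate :: "real \<Rightarrow> 'a pair_pre_digraph \<Rightarrow> (nat \<Rightarrow> nat) \<Rightarrow> real" where
  "leakage_rate b G g = lim (normalized_min_leakage b G g)"

end

(*
Lower bound: under the uniform source the k likeliest of at most A candidates carry at least the
fraction k/A of their total mass, and every code symbol leaves at most
A = \<alpha>(\<Gamma>_t) \<le> \<alpha>(\<Gamma>)^t candidates, since an independent set of \<Gamma>_t lies
in the product of its coordinate projections, which are independent in \<Gamma>.  Upper bound: the
t-fold product of a d-fold colouring of \<Gamma> with m colours is a d^t-fold colouring of \<Gamma>_t
with m^t colours, and sending a sequence to a uniformly chosen one of its colours costs at most the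
factor (m/d)^t, whatever the source.
*)

theory Submission
  imports Defs
begin

section \<open>Heaviest subsets of given size in a weighted finite set\<close>

text \<open>Deleting an element of least weight never lowers the average weight, so such deletions
  lead from \<open>U\<close> down to a suitable \<open>K\<close> of size \<open>k\<close>. Averages
  are compared cross-multiplied, which makes sense for empty sets too.\<close>

lemma subset_sum_ge_average:
  fixes w :: "'b \<Rightarrow> real"
  assumes "finite U" "k \<le> card U"
  shows "\<exists>K\<subseteq>U. card K = k \<and> real k * sum w U \<le> real (card U) * sum w K"
  using assms
proof (induction U rule: finite_remove_induct)
  case empty
  then show ?case by auto
next
  case (remove U)
  show ?case
  proof (cases "k = card U \<or> k = 0")
    case True
    then show ?thesis by (elim disjE) (auto intro: exI[of _ U] exI[of _ "{}"])
  next
    case False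
    then have k: "1 \<le> k" "k < card U" using remove.prems by auto
    have "\<exists>x\<in>U. \<forall>y\<in>U. w x \<le> w y"
      using arg_min_if_finite(1)[of U w] arg_min_least[of U _ w] remove.hyps by metis
    then obtain x where x: "x \<in> U" "\<And>y. y \<in> U \<Longrightarrow> w x \<le> w y" by blast
    have c: "real (card (U - {x})) = real (card U) - 1"
      using x(1) remove.hyps(1) k by (simp add: card_Diff_singleton of_nat_diff)
    have "k \<le> card (U - {x})"
      using x(1) remove.hyps(1) k by (simp add: card_Diff_singleton)
    from remove.IH[OF x(1) this] obtain K where K: "K \<subseteq> U - {x}" "card K = k"
      "real k * sum w (U - {x}) \<le> real (card (U - {x})) * sum w K" by blast
    have s: "sum w (U - {x}) = sum w U - w x"
      using x(1) remove.hyps(1) by (simp add: sum_diff1)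
    have m: "real (card U) * w x \<le> sum w U"
      using sum_bounded_below[of U "w x" w] x(2) by simp
    define a where "a = real (card U)"
    \<comment> \<open>With the extreme cases \<open>k = 0\<close> and \<open>k = card U\<close> set
      aside, \<open>a - 1\<close> is positive and can be cancelled at the end.\<close>
    have a: "1 < a" using k by (simp add: a_def)
    have "(a - 1) * (real k * sum w U) \<le> real k * (a * sum w U - a * w x)"
      using mult_left_mono[OF m, of "real k"] by (simp add: a_def algebra_simps)
    also have "\<dots> = a * (real k * sum w (U - {x}))" by (simp add: s algebra_simps)
    also have "\<dots> \<le> a * ((a - 1) * sum w K)"
      using K(3) a by (intro mult_left_mono) (auto simp: c a_def)
    finally have "(a - 1) * (real k * sum w U) \<le> (a - 1) * (a * sum w K)"
      by (simp add: algebra_simps)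
    then have "real k * sum w U \<le> a * sum w K" using a by simp
    then show ?thesis using K by (auto simp: a_def)
  qed
qed

lemma max_guess_ge:
  assumes "finite S" "K \<subseteq> S" "card K = k"
  shows "sum w K \<le> max_guess k S w"
  unfolding max_guess_def by (intro Max_ge) (use assms in auto)

lemma max_guess_le:
  assumes "finite S" "k \<le> card S" "\<And>K. K \<subseteq> S \<Longrightarrow> card K = k \<Longrightarrow> sum w K \<le> c"
  shows "max_guess k S w \<le> c"
proof -
  obtain K where "K \<subseteq> S" "card K = k"
    using obtain_subset_with_card_n[OF assms(2)] by metis
  then show ?thesis
    unfolding max_guess_def using assms by (subst Max_le_iff) auto
qed

text \<open>The support of \<open>w\<close> may have fewer than \<open>k\<close> elements, so it is
  first padded with elements of weight zero to a set of exactly \<open>A\<close> elements. Averaging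
  over the padded set keeps the total weight and yields the fraction \<open>k / A\<close>.\<close>

lemma max_guess_ge_average:
  fixes w :: "'b \<Rightarrow> real"
  assumes "finite S" "k \<le> A" "1 \<le> A" "A \<le> card S"
    and "U \<subseteq> S" "card U \<le> A" "\<And>x. x \<in> S - U \<Longrightarrow> w x = 0"
  shows "real k / real A * sum w S \<le> max_guess k S w"
proof -
  obtain U' where U': "U \<subseteq> U'" "U' \<subseteq> S" "card U' = A"
    using exists_subset_between[of U A S] assms by blast
  have fin: "finite U'" using U' assms(1) finite_subset by blast
  have eq: "sum w S = sum w U'"
    using assms U' by (intro sum.mono_neutral_right) auto
  obtain K where K: "K \<subseteq> U'" "card K = k" "real k * sum w U' \<le> real A * sum w K"
    using subset_sum_ge_average[OF fin, of k w] U'(3) assms(2) by auto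
  have "real k / real A * sum w S \<le> sum w K"
    using K(3) assms(3) by (simp add: eq field_simps)
  also have "\<dots> \<le> max_guess k S w"
    using K U' assms(1) by (intro max_guess_ge) auto
  finally show ?thesis .
qed

section \<open>Independence numbers of a graph and its OR powers\<close>

lemma finite_independent_sets:
  assumes "finite (pverts G)"
  shows "finite {S. independent_set G S}"
  by (rule finite_subset[of _ "Pow (pverts G)"]) (use assms in \<open>auto simp: independent_set_def\<close>)

lemma card_le_independence_number:
  assumes "finite (pverts G)" "independent_set G S"
  shows "card S \<le> independence_number G"
  unfolding independence_number_def
  by (rule Max_ge) (use finite_independent_sets[OF assms(1)] assms(2) in auto)

lemma independence_number_attained:
  assumes "finite (pverts G)"
  obtains S where "independent_set G S" "card S = independence_number G"
proof -
  have "independent_set G {}" by (simp add: independent_set_def)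
  then have "independence_number G \<in> card ` {S. independent_set G S}"
    unfolding independence_number_def
    using finite_independent_sets[OF assms] by (intro Max_in) auto
  then show ?thesis using that by auto
qed

lemma finite_seqs: "finite V \<Longrightarrow> finite (seqs t V)"
  by (intro finite_PiE) auto

lemma card_seqs: "card (seqs t V) = card V ^ t"
  by (simp add: card_PiE)

lemma pverts_or_power [simp]: "pverts (or_power G t) = seqs t (pverts G)"
  by (simp add: or_power_def)

text \<open>Members of an independent set of the power are non-adjacent in every coordinate, so each
  projection \<open>T j\<close> is independent in \<open>G\<close>, and the set is contained in the
  product of these projections.\<close>

lemma independence_number_or_power_le:
  assumes "finite (pverts G)"
  shows "independence_number (or_power G t) \<le> independence_number G ^ t"
proof -
  obtain S where S: "independent_set (or_power G t) S" "card S = independence_number (or_power G t)"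
    using independence_number_attained[of "or_power G t"] finite_seqs[OF assms] by auto
  define T where "T j = (\<lambda>x. x j) ` S" for j
  have sub: "S \<subseteq> seqs t (pverts G)"
    using S(1) by (simp add: independent_set_def)
  have "(x j, v j) \<notin> parcs G" if "j < t" "x \<in> S" "v \<in> S" for j x v
  proof -
    have "(x, v) \<notin> parcs (or_power G t)" using S(1) that by (simp add: independent_set_def)
    then show ?thesis using that sub by (auto simp: or_power_def)
  qed
  then have T: "independent_set G (T j)" if "j < t" for j
    using sub that unfolding independent_set_def T_def by blast
  have finT: "finite (T j)" if "j < t" for j
    using T[OF that] assms by (auto simp: independent_set_def intro: finite_subset)
  have "S \<subseteq> (\<Pi>\<^sub>E j\<in>{..<t}. T j)"
    using sub by (auto simp: T_def PiE_def)
  then have "card S \<le> card (\<Pi>\<^sub>E j\<in>{..<t}. T j)"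
    using finT by (intro card_mono finite_PiE) auto
  also have "\<dots> = (\<Prod>j<t. card (T j))" by (simp add: card_PiE)
  also have "\<dots> \<le> (\<Prod>j<t. independence_number G)"
    by (intro prod_mono) (use T card_le_independence_number[OF assms] in auto)
  finally show ?thesis using S(2) by simp
qed

text \<open>This ensures that there are enough sequences to form sets of \<open>g t\<close> guesses
  and to pad a support to the independence number.\<close>

lemma independence_number_or_power_le_card:
  assumes "finite (pverts G)"
  shows "independence_number (or_power G t) \<le> card (seqs t (pverts G))"
proof -
  obtain S where S: "independent_set (or_power G t) S" "card S = independence_number (or_power G t)"
    using independence_number_attained[of "or_power G t"] finite_seqs[OF assms] by auto
  then show ?thesis
    using card_mono[OF finite_seqs[OF assms], of S t] by (simp add: independent_set_def)
qed

section \<open>Lower bound from the uniform source\<close>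

text \<open>The numerator is at least \<open>k / ?A\<close> by averaging within each symbol, and the
  denominator is at most \<open>k / ?n ^ t\<close> because all sequences are equally likely. The
  factor \<open>k\<close> cancels, which is why the bound is the same for every guessing
  capability.\<close>

lemma guess_ratio_uniform_ge:
  assumes "finite (pverts G)" "pverts G \<noteq> {}" "valid_mapping G t Y P"
    and "1 \<le> k" "k \<le> independence_number (or_power G t)"
  shows "real (card (pverts G)) ^ t / real (independence_number (or_power G t))
           \<le> guess_ratio (pverts G) t k Y P (pmf_of_set (pverts G))"
proof -
  let ?V = "pverts G"
  let ?S = "seqs t ?V"
  let ?n = "real (card ?V)"
  let ?A = "independence_number (or_power G t)"
  let ?w = "iid_prob (pmf_of_set ?V) t"
  have finS: "finite ?S" using assms(1) by (rule finite_seqs)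
  have n: "?n > 0" using assms(1,2) by (simp add: card_gt_0_iff)
  have A: "1 \<le> ?A" "?A \<le> card ?S"
    using assms(4,5) independence_number_or_power_le_card[OF assms(1)] by auto
  have w: "?w x = 1 / ?n ^ t" if "x \<in> ?S" for x
    using that assms(1,2) unfolding iid_prob_def
    by (subst prod.cong[OF refl, of _ _ "\<lambda>_. 1 / ?n"]) (auto simp: PiE_iff power_one_over)
  have num: "real k / real ?A \<le> (\<Sum>y\<in>Y. max_guess k ?S (\<lambda>x. ?w x * pmf (P x) y))"
  proof -
    \<comment> \<open>The joint distribution of sequence and symbol has total mass 1, so the
      averaging bound may be applied to each symbol and summed.\<close>
    have "(\<Sum>y\<in>Y. \<Sum>x\<in>?S. ?w x * pmf (P x) y) = (\<Sum>x\<in>?S. ?w x * (\<Sum>y\<in>Y. pmf (P x) y))"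
      by (subst sum.swap) (simp add: sum_distrib_left)
    also have "\<dots> = (\<Sum>x\<in>?S. 1 / ?n ^ t)"
      using assms(3) by (intro sum.cong) (auto simp: w valid_mapping_def sum_pmf_eq_1)
    also have "\<dots> = 1" using n card_seqs[of t ?V] by simp
    finally have "real k / real ?A = (\<Sum>y\<in>Y. real k / real ?A * (\<Sum>x\<in>?S. ?w x * pmf (P x) y))"
      by (subst sum_distrib_left[symmetric]) simp
    also have "\<dots> \<le> (\<Sum>y\<in>Y. max_guess k ?S (\<lambda>x. ?w x * pmf (P x) y))"
    proof (rule sum_mono)
      fix y assume y: "y \<in> Y"
      let ?U = "{x \<in> ?S. pmf (P x) y > 0}"
      have "independent_set (or_power G t) ?U" using assms(3) y by (simp add: valid_mapping_def)
      then have "card ?U \<le> ?A" using finS by (intro card_le_independence_number) auto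
      then show "real k / real ?A * (\<Sum>x\<in>?S. ?w x * pmf (P x) y)
                   \<le> max_guess k ?S (\<lambda>x. ?w x * pmf (P x) y)"
        using A assms(5) finS by (intro max_guess_ge_average[where U = ?U]) (auto simp: set_pmf_iff pmf_positive_iff)
    qed
    finally show ?thesis .
  qed
  have den: "max_guess k ?S ?w \<le> real k / ?n ^ t"
  proof (rule max_guess_le[OF finS])
    fix K assume K: "K \<subseteq> ?S" "card K = k"
    have "sum ?w K = (\<Sum>x\<in>K. 1 / ?n ^ t)" by (intro sum.cong) (use K w in auto)
    then show "sum ?w K \<le> real k / ?n ^ t" using K by simp
  qed (use A assms in auto)
  have pos: "0 < max_guess k ?S ?w"
    using A assms by (intro max_guess_iid_prob_pos) auto
  have "?n ^ t / real ?A = (real k / real ?A) / (real k / ?n ^ t)"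
    using assms(4) by simp
  also have "\<dots> \<le> (\<Sum>y\<in>Y. max_guess k ?S (\<lambda>x. ?w x * pmf (P x) y)) / max_guess k ?S ?w"
    by (rule frac_le) (use num den pos in \<open>auto intro: order_trans[OF _ num]\<close>)
  finally show ?thesis by (simp add: guess_ratio_def)
qed

section \<open>Multiple colourings and their products\<close>

text \<open>Indexed form of the multisets behind \<open>multi_chromatic_number\<close>: repeated
  classes get distinct indices, and these later serve as code symbols.\<close>

definition fold_colouring :: "'a pair_pre_digraph \<Rightarrow> nat \<Rightarrow> nat \<Rightarrow> (nat \<Rightarrow> 'a set) \<Rightarrow> bool" where
  "fold_colouring G d m T \<longleftrightarrow>
     (\<forall>i<m. independent_set G (T i)) \<and> (\<forall>v\<in>pverts G. card {i. i < m \<and> v \<in> T i} = d)"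

text \<open>The least size is attained once some \<open>d\<close>-fold colouring exists. Taking
  every singleton \<open>d\<close> times gives one, singletons being independent because there are
  no loops.\<close>

lemma fold_colouring_multi_chromatic_number:
  assumes "pair_graph G"
  shows "\<exists>T. fold_colouring G d (multi_chromatic_number G d) T"
proof -
  interpret pair_graph G by fact
  let ?Q = "\<lambda>m. \<exists>T :: 'a set multiset. size T = m \<and> (\<forall>S \<in># T. independent_set G S) \<and>
                  (\<forall>v \<in> pverts G. size (filter_mset (\<lambda>S. v \<in> S) T) = d)"
  define T0 where "T0 = (\<Sum>v\<in>pverts G. replicate_mset d {v})"
  have ind: "independent_set G S" if "S \<in># T0" for S
    using that no_loops' by (auto simp: T0_def independent_set_def set_mset_sum split: if_splits)
  have sz: "size (filter_mset (\<lambda>S. v \<in> S) T0) = d" if "v \<in> pverts G" for v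
  proof -
    have *: "size (filter_mset (\<lambda>S. v \<in> S) (\<Sum>u\<in>A. replicate_mset d {u})) =
            (\<Sum>u\<in>A. if u = v then d else 0)" if "finite A" for A
      using that
    proof (induction A rule: finite_induct)
      case (insert u A)
      have "size (filter_mset (\<lambda>S. v \<in> S) (replicate_mset d {u})) = (if u = v then d else 0)"
        by (induction d) auto
      then show ?case using insert by auto
    qed simp
    show ?thesis using that by (simp add: T0_def *)
  qed
  have "?Q (size T0)" using ind sz by blast
  then have "?Q (multi_chromatic_number G d)"
    unfolding multi_chromatic_number_def by (rule LeastI)
  then obtain T where T: "size T = multi_chromatic_number G d" "\<forall>S \<in># T. independent_set G S"
     "\<forall>v \<in> pverts G. size (filter_mset (\<lambda>S. v \<in> S) T) = d" by blast
  \<comment> \<open>Listing the multiset turns multiplicities into distinct positions.\<close>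
  obtain xs where xs: "mset xs = T" using ex_mset by blast
  have "card {i. i < length xs \<and> v \<in> xs ! i} = size (filter_mset (\<lambda>S. v \<in> S) T)" for v
    using length_filter_conv_card[of "\<lambda>S. v \<in> S" xs] by (simp flip: xs mset_filter)
  then have "fold_colouring G d (multi_chromatic_number G d) ((!) xs)"
    using T xs by (auto simp: fold_colouring_def simp flip: T(1))
  then show ?thesis by blast
qed

text \<open>The colours of the power are \<open>t\<close>-tuples of colours, and the class of a
  tuple is the product of its coordinate classes. A sequence has \<open>d\<close> choices of colour
  in each coordinate, hence \<open>d ^ t\<close> tuples.\<close>

lemma fold_colouring_or_power:
  assumes "fold_colouring G d m T"
  shows "\<exists>T'. fold_colouring (or_power G t) (d ^ t) (m ^ t) T'"
proof -
  define I where "I = seqs t {..<m}"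
  define F where "F y = (\<Pi>\<^sub>E j\<in>{..<t}. T (y j))" for y
  have finI: "finite I" by (simp add: I_def finite_seqs)
  have cI: "card I = m ^ t" by (simp add: I_def card_seqs)
  \<comment> \<open>Colours must be an initial segment of the naturals, so the tuples are renumbered
    by \<open>f\<close>.\<close>
  obtain f where f: "bij_betw f {..<m ^ t} I"
    using ex_bij_betw_nat_finite[OF finI] by (auto simp: cI atLeast0LessThan)
  have T: "independent_set G (T i)" if "i < m" for i
    using assms that by (simp add: fold_colouring_def)
  have "independent_set (or_power G t) (F (f i))" if "i < m ^ t" for i
  proof -
    have "f i \<in> I" using f that by (auto simp: bij_betw_def)
    then have "f i j < m" if "j < t" for j using that by (auto simp: I_def PiE_iff)
    then have fj: "independent_set G (T (f i j))" if "j < t" for j using T that by blast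
    have "F (f i) \<subseteq> seqs t (pverts G)"
      unfolding F_def by (intro PiE_mono) (use fj in \<open>auto simp: independent_set_def\<close>)
    moreover have "(u, v) \<notin> parcs (or_power G t)" if "u \<in> F (f i)" "v \<in> F (f i)" for u v
    proof -
      have "(u j, v j) \<notin> parcs G" if "j < t" for j
        using fj[OF that] \<open>u \<in> F (f i)\<close> \<open>v \<in> F (f i)\<close> that
        by (simp add: independent_set_def F_def PiE_iff)
      then show ?thesis by (simp add: or_power_def)
    qed
    ultimately show ?thesis by (simp add: independent_set_def)
  qed
  moreover have "card {i. i < m ^ t \<and> x \<in> F (f i)} = d ^ t" if x: "x \<in> seqs t (pverts G)" for x
  proof -
    have "bij_betw f {i. i < m ^ t \<and> x \<in> F (f i)} {y \<in> I. x \<in> F y}"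
      using f by (auto simp: bij_betw_def inj_on_def)
    then have "card {i. i < m ^ t \<and> x \<in> F (f i)} = card {y \<in> I. x \<in> F y}"
      by (rule bij_betw_same_card)
    also have "{y \<in> I. x \<in> F y} = (\<Pi>\<^sub>E j\<in>{..<t}. {i. i < m \<and> x j \<in> T i})"
      using x by (auto simp: I_def F_def PiE_iff extensional_def)
    also have "card \<dots> = (\<Prod>j<t. card {i. i < m \<and> x j \<in> T i})" by (simp add: card_PiE)
    also have "\<dots> = (\<Prod>j<t. d)"
      using assms x by (intro prod.cong) (auto simp: fold_colouring_def PiE_iff)
    finally show ?thesis by simp
  qed
  ultimately have "fold_colouring (or_power G t) (d ^ t) (m ^ t) (F \<circ> f)"
    by (simp add: fold_colouring_def)
  then show ?thesis by blast
qed

section \<open>Random choice of a colour as a mapping scheme\<close>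

text \<open>The sequences that can produce the symbol \<open>y\<close> all lie in the class
  \<open>T y\<close>, which gives validity. The choice is uniform among exactly \<open>D\<close>
  colours, which gives the bound \<open>1 / D\<close>.\<close>

lemma colouring_scheme:
  assumes "finite (pverts G)" "fold_colouring (or_power G t) D M T" "1 \<le> D"
  obtains P where "valid_mapping G t {..<M} P"
    "\<And>x y. x \<in> seqs t (pverts G) \<Longrightarrow> pmf (P x) y \<le> 1 / real D"
proof -
  define P where "P x = pmf_of_set {i. i < M \<and> x \<in> T i}" for x
  have T: "independent_set (or_power G t) (T i)" if "i < M" for i
    using assms(2) that by (simp add: fold_colouring_def)
  have c: "card {i. i < M \<and> x \<in> T i} = D" if "x \<in> seqs t (pverts G)" for x
    using assms(2) that by (simp add: fold_colouring_def)
  \<comment> \<open>\<open>pmf_of_set\<close> is the uniform distribution only on nonempty finite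
    sets; here \<open>1 \<le> D\<close> enters.\<close>
  have ne: "{i. i < M \<and> x \<in> T i} \<noteq> {}" if "x \<in> seqs t (pverts G)" for x
    using c[OF that] assms(3) by (metis card.empty not_one_le_zero)
  have p: "pmf (P x) y = (if y < M \<and> x \<in> T y then 1 / real D else 0)"
    if "x \<in> seqs t (pverts G)" for x y
    unfolding P_def using ne[OF that] c[OF that] by (subst pmf_of_set) (auto simp: indicator_def)
  have "set_pmf (P x) \<subseteq> {..<M}" if "x \<in> seqs t (pverts G)" for x
    using p[OF that] by (auto simp: set_pmf_iff split: if_splits)
  moreover have "independent_set (or_power G t) {x \<in> seqs t (pverts G). pmf (P x) y > 0}"
    if "y < M" for y
    using T[OF that] that p by (auto simp: independent_set_def split: if_splits)
  ultimately have "valid_mapping G t {..<M} P" by (simp add: valid_mapping_def)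
  moreover have "pmf (P x) y \<le> 1 / real D" if "x \<in> seqs t (pverts G)" for x y
    using p[OF that] by simp
  ultimately show ?thesis using that by blast
qed

text \<open>Bounding the kernel by \<open>c\<close> makes each summand of the numerator at most
  \<open>c\<close> times the denominator, so the source distribution cancels.\<close>

lemma guess_ratio_le:
  assumes "finite V" "set_pmf p \<subseteq> V" "1 \<le> k" "k \<le> card (seqs t V)"
    and "\<And>x y. x \<in> seqs t V \<Longrightarrow> pmf (P x) y \<le> c"
  shows "guess_ratio V t k Y P p \<le> real (card Y) * c"
proof -
  let ?S = "seqs t V"
  let ?M = "max_guess k ?S (iid_prob p t)"
  have finS: "finite ?S" using assms(1) by (rule finite_seqs)
  have pos: "0 < ?M" using assms by (intro max_guess_iid_prob_pos)
  \<comment> \<open>Any single kernel value, here at the arbitrary symbol 0, shows that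
    \<open>c\<close> is nonnegative, as scaling by \<open>c\<close> requires.\<close>
  obtain x0 where "x0 \<in> ?S" using assms(3,4) by (metis card.empty ex_in_conv le_zero_eq not_one_le_zero)
  then have c: "0 \<le> c" using assms(5)[of x0 0] pmf_nonneg[of "P x0" 0] by linarith
  have "max_guess k ?S (\<lambda>x. iid_prob p t x * pmf (P x) y) \<le> c * ?M" for y
  proof (rule max_guess_le[OF finS assms(4)])
    fix K assume K: "K \<subseteq> ?S" "card K = k"
    have "(\<Sum>x\<in>K. iid_prob p t x * pmf (P x) y) \<le> (\<Sum>x\<in>K. iid_prob p t x * c)"
      by (intro sum_mono mult_left_mono) (use K assms(5) in \<open>auto simp: iid_prob_def intro!: prod_nonneg\<close>)
    also have "\<dots> = c * sum (iid_prob p t) K" by (simp add: sum_distrib_left mult.commute)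
    also have "\<dots> \<le> c * ?M" by (intro mult_left_mono max_guess_ge finS K c)
    finally show "(\<Sum>x\<in>K. iid_prob p t x * pmf (P x) y) \<le> c * ?M" .
  qed
  then have "(\<Sum>y\<in>Y. max_guess k ?S (\<lambda>x. iid_prob p t x * pmf (P x) y)) \<le> real (card Y) * (c * ?M)"
    by (intro sum_bounded_above)
  then show ?thesis using pos by (simp add: guess_ratio_def field_simps)
qed

section \<open>Both bounds at a fixed length\<close>

text \<open>The upper bound is exponentiated so that it compares directly with the terms whose
  infimum is the fractional chromatic number; logarithms are taken only after that infimum is known
  to be positive.\<close>

lemma normalized_min_leakage_bounds:
  fixes G :: "'a pair_pre_digraph"
  assumes "b > 1" and pg: "pair_graph G" and ne: "pverts G \<noteq> {}" and "guessing_capability G g"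
    and t: "1 \<le> t" and d: "1 \<le> d"
  shows "log b (real (card (pverts G))) - log b (real (independence_number G))
           \<le> normalized_min_leakage b G g t" (is ?lower)
    and "b powr normalized_min_leakage b G g t
           \<le> real (multi_chromatic_number G d) / real d" (is ?upper)
proof -
  interpret pair_graph G by (rule pg)
  let ?V = "pverts G" and ?k = "g t"
  let ?n = "real (card ?V)" and ?a = "real (independence_number G)"
  let ?A = "independence_number (or_power G t)"
  let ?sup = "\<lambda>Y P. SUP q\<in>{q. set_pmf q \<subseteq> ?V}. guess_ratio ?V t ?k Y P q"
  have fin: "finite ?V" by simp
  have k: "1 \<le> ?k" "?k \<le> ?A" using assms(4) t by (auto simp: guessing_capability_def)
  have kS: "?k \<le> card (seqs t ?V)"
    using k independence_number_or_power_le_card[OF fin] by (rule_tac order_trans)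
  have n: "0 < ?n" using ne by (simp add: card_gt_0_iff)
  have "1 \<le> independence_number G ^ t"
    using k independence_number_or_power_le[OF fin, of t] by linarith
  \<comment> \<open>\<open>t\<close> must be positive here, since \<open>0 ^ 0 = 1\<close>.\<close>
  then have a: "0 < ?a" using t by (cases "independence_number G = 0") (auto simp: power_0_left)
  have sup_ge: "(?n / ?a) ^ t \<le> ?sup Y P" if v: "valid_mapping G t Y P" for Y P
  proof -
    have "(?n / ?a) ^ t = ?n ^ t / real (independence_number G ^ t)" by (simp add: power_divide)
    also have "\<dots> \<le> ?n ^ t / real ?A"
      using k independence_number_or_power_le[OF fin, of t] a n
      by (intro divide_left_mono mult_pos_pos of_nat_mono) auto
    also have "\<dots> \<le> guess_ratio ?V t ?k Y P (pmf_of_set ?V)"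
      using fin ne v k by (rule guess_ratio_uniform_ge)
    also have "\<dots> \<le> ?sup Y P"
    proof -
      \<comment> \<open>Attainment of the supremum makes it an upper bound; in particular the real
        \<open>SUP\<close> is not a default value.\<close>
      obtain p where "\<forall>q. set_pmf q \<subseteq> ?V \<longrightarrow> guess_ratio ?V t ?k Y P q \<le> guess_ratio ?V t ?k Y P p"
        "guess_ratio ?V t ?k Y P p = ?sup Y P"
        using guess_ratio_attains_Sup[OF fin ne k(1) kS, of Y P] by blast
      then show ?thesis using ne by (metis fin set_pmf_of_set subset_refl)
    qed
    finally show ?thesis .
  qed
  have leak_ge: "real t * (log b ?n - log b ?a) \<le> multi_guess_leakage b G g t Y P"
    if v: "valid_mapping G t Y P" for Y P
  proof -
    have "real t * (log b ?n - log b ?a) = log b ((?n / ?a) ^ t)"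
      using n a by (simp add: log_nat_power log_divide_pos)
    also have "\<dots> \<le> log b (?sup Y P)"
      using sup_ge[OF v] n a assms(1) by (intro log_mono) auto
    finally show ?thesis by (simp add: multi_guess_leakage_def)
  qed
  obtain T where "fold_colouring G d (multi_chromatic_number G d) T"
    using fold_colouring_multi_chromatic_number[OF pg] by blast
  then obtain T' where T': "fold_colouring (or_power G t) (d ^ t) (multi_chromatic_number G d ^ t) T'"
    using fold_colouring_or_power by blast
  let ?M = "multi_chromatic_number G d"
  have "1 \<le> d ^ t" using d by simp
  then obtain P where P: "valid_mapping G t {..<?M ^ t} P"
    "\<And>x y. x \<in> seqs t ?V \<Longrightarrow> pmf (P x) y \<le> 1 / real (d ^ t)"
    using colouring_scheme[OF fin T'] by metis
  let ?L = "INF (Y, P)\<in>{(Y, P). valid_mapping G t Y P}. multi_guess_leakage b G g t Y P"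
  \<comment> \<open>The colouring scheme \<open>P\<close> witnesses that the infimum is over a
    nonempty family.\<close>
  have "real t * (log b ?n - log b ?a) \<le> ?L"
    by (rule cINF_greatest) (use P(1) leak_ge in auto)
  then show ?lower using t by (simp add: normalized_min_leakage_def field_simps)
  \<comment> \<open>The uniform lower bound on the leakage is what allows the infimum to be compared
    with the leakage of one particular scheme.\<close>
  have bdd: "bdd_below ((\<lambda>(Y, P). multi_guess_leakage b G g t Y P) ` {(Y, P). valid_mapping G t Y P})"
    by (rule bdd_belowI2[of _ "real t * (log b ?n - log b ?a)"]) (use leak_ge in auto)
  have L_le: "?L \<le> multi_guess_leakage b G g t {..<?M ^ t} P"
    using cINF_lower[OF bdd, of "({..<?M ^ t}, P)"] P(1) by simp
  have sup_le: "?sup {..<?M ^ t} P \<le> (real ?M / real d) ^ t"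
  proof (rule cSUP_least)
    have "pmf_of_set ?V \<in> {q. set_pmf q \<subseteq> ?V}" using ne by simp
    then show "{q. set_pmf q \<subseteq> ?V} \<noteq> {}" by (metis empty_iff)
    fix q assume "q \<in> {q. set_pmf q \<subseteq> ?V}"
    then have "guess_ratio ?V t ?k {..<?M ^ t} P q \<le> real (card {..<?M ^ t}) * (1 / real (d ^ t))"
      using fin k(1) kS P(2) by (intro guess_ratio_le) auto
    then show "guess_ratio ?V t ?k {..<?M ^ t} P q \<le> (real ?M / real d) ^ t"
      by (simp add: power_divide)
  qed
  \<comment> \<open>Positivity of the supremum comes from the lower bound. It justifies the
    monotonicity of \<open>log\<close> and forces \<open>?M\<close> to be nonzero.\<close>
  have pos: "0 < ?sup {..<?M ^ t} P"
    by (rule less_le_trans[OF _ sup_ge[OF P(1)]]) (use n a in simp)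
  have "0 < (real ?M / real d) ^ t" using pos sup_le by (rule less_le_trans)
  then have M: "0 < real ?M / real d"
    using t d by (cases "?M = 0") (auto simp: power_0_left)
  note L_le
  also have "multi_guess_leakage b G g t {..<?M ^ t} P \<le> log b ((real ?M / real d) ^ t)"
    unfolding multi_guess_leakage_def by (rule log_mono[OF assms(1) pos sup_le])
  also have "\<dots> = real t * log b (real ?M / real d)" using M by (simp add: log_nat_power)
  finally have "normalized_min_leakage b G g t \<le> log b (real ?M / real d)"
    using t by (simp add: normalized_min_leakage_def field_simps)
  then show ?upper using M assms(1) by (simp add: le_log_iff)
qed

section \<open>Passage to the limit\<close>

theorem theorem2:
  fixes G :: "'a pair_pre_digraph" and g :: "nat \<Rightarrow> nat" and b :: real
  assumes "b > 1"
    and "pair_graph G" and "pverts G \<noteq> {}"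
    and "guessing_capability G g"
    and "convergent (normalized_min_leakage b G g)"
  shows "log b (real (card (pverts G))) - log b (real (independence_number G)) \<le> leakage_rate b G g \<and>
         leakage_rate b G g \<le> log b (fractional_chromatic_number G)"
proof
  have lim: "normalized_min_leakage b G g \<longlonglongrightarrow> leakage_rate b G g"
    using assms(5) by (simp add: leakage_rate_def convergent_LIMSEQ_iff)
  note bounds = normalized_min_leakage_bounds[OF assms(1-4)]
  show "log b (real (card (pverts G))) - log b (real (independence_number G)) \<le> leakage_rate b G g"
    by (rule LIMSEQ_le_const[OF lim]) (use bounds(1)[where d = 1] in auto)
  \<comment> \<open>The limit is taken for each fixed \<open>d\<close> first, and the infimum over
    \<open>d\<close> afterwards.\<close>
  have "b powr leakage_rate b G g \<le> real (multi_chromatic_number G d) / real d" if "1 \<le> d" for d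
    by (rule LIMSEQ_le_const2[OF tendsto_powr[OF tendsto_const lim]])
      (use bounds(2)[OF _ that] assms(1) in auto)
  then have "b powr leakage_rate b G g \<le> fractional_chromatic_number G"
    unfolding fractional_chromatic_number_def by (intro cINF_greatest) auto
  \<comment> \<open>A power of \<open>b\<close> is positive, so the infimum over \<open>d\<close>
    cannot be 0 and its logarithm is genuine.\<close>
  moreover from this have "0 < fractional_chromatic_number G"
    using assms(1) by (auto intro: less_le_trans[rotated])
  ultimately show "leakage_rate b G g \<le> log b (fractional_chromatic_number G)"
    using assms(1) by (simp add: le_log_iff)
qed

end
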